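(* Let $\Lambda_{BD}$ be the $2$-graph associated to basic data $BD=(T,A,\{f_p:p\in A^P\})$. If $BD$ has an $a$-breaking cycle for some $a\in A$, then $\Lambda_{BD}$ is aperiodic.
   Context: $\mathbb N=\{0,1,2,\dots\}$; $\mathbb N^2$ is a semigroup under addition with basis $e_1,e_2$ and the coordinatewise partial order $\le$; $m\vee n$, $m\wedge n$ are the coordinatewise maximum and minimum. A tile $T$ is a nonempty finite subset of $\mathbb N^2$ that is hereditary ($n\in T$ and $0\le m\le n$ imply $m\in T$); $(c_1,c_2)$ denotes the coordinatewise maximum of the elements of $T$; $T$ is nondegenerate if $|T|\ge 2$. For nondegenerate $T$ put $P=T\setminus\{c_1e_1,c_2e_2\}$. Basic data is a triple $BD=(T,A,\{f_p:p\in A^P\})$ where $T$ is a nondegenerate tile, $A$ is a finite nonempty set, and for each function $p\in A^P$ (with $A^\emptyset=\{\emptyset\}$), $f_p:A\to A$ is a bijection. For $p\in A^P$, $a\in A$ define $F_{p,a}:T\to A$ by $F_{p,a}(c_2e_2)=a$, $F_{p,a}(c_1e_1)=f_p(a)$, $F_{p,a}(t)=p(t)$ for $t\in P$, and let $\Lambda_{BD}^0=\{F_{p,a}:p\in A^P,a\in A\}$. For $S\subset\mathbb N^2$, $n\in\mathbb N^2$ let $S+n=\{m+n:m\in S\}$, and $T(n)=\bigcup_{0\le m\le n}(T+m)$. If $f:S\to A$ with $T+n\subset S$, define $f\downarrow_{T+n}:T\to A$ by $f\downarrow_{T+n}(i)=f(i+n)$. A path of degree $n\in\mathbb N^2$ is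 a function $\lambda:T(n)\to A$ with $\lambda\downarrow_{T+m}\in\Lambda_{BD}^0$ for all $0\le m\le n$; its range is $r(\lambda)=\lambda\downarrow_T$ and its source is $s(\lambda)=\lambda\downarrow_{T+n}$. $\Lambda_{BD}^n$ is the set of paths of degree $n$. For $\lambda\in\Lambda_{BD}^\ell$ and $0\le m\le n\le\ell$, $\lambda(m,n)$ is the path of degree $n-m$ given by $\lambda(m,n)(i)=\lambda(m+i)$ for $i\in T(n-m)$. The $2$-graph $\Lambda_{BD}$ is the category with objects $\Lambda_{BD}^0$, morphisms all paths, degree map $d(\lambda)=n$ for $\lambda\in\Lambda_{BD}^n$, and composite $\mu\nu$ (for $s(\mu)=r(\nu)$) the unique path $\lambda$ of degree $d(\mu)+d(\nu)$ with $\lambda(0,d(\mu))=\mu$, $\lambda(d(\mu),d(\mu)+d(\nu))=\nu$. Write $u\Lambda^n v=\{\lambda\in\Lambda_{BD}^n:r(\lambda)=u,\ s(\lambda)=v\}$. For $a\in A$, $BD$ has a blue $a$-breaking cycle if $T\cap(T+e_2)\neq\emptyset$ and there exist $k>1$ and distinct $v_1,\dots,v_k\in\Lambda_{BD}^0$ such that $v_i|_{T\cap(T+e_2)}\equiv a$ for every $i\in\{1,\dots,k\}$ and either (1) $|v_i\Lambda^{e_1}v_{i+1}|=1$ for every $i\in\{1,\dots,k\}$, where $v_{k+1}=v_1$; or (2) $|v_i\Lambda^{e_1}v_i|=1$ for every $i\in\{1,\dots,k\}$. A red $a$-breaking cycle is defined in the same way with the roles of $e_1$ and $e_2$ interchanged.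 $BD$ has an $a$-breaking cycle if it has a blue or a red $a$-breaking cycle. A row-finite $2$-graph $\Lambda$ with no sources ($0<|v\Lambda^n|<\infty$ for all $v\in\Lambda^0$, $n\in\mathbb N^2$, where $v\Lambda^n$ is the set of paths of degree $n$ with range $v$) is aperiodic if for every $v\in\Lambda^0$ and all distinct $m,n\in\mathbb N^2$ with $m\wedge n=0$ there is $\lambda\in\Lambda$ with $r(\lambda)=v$, $d(\lambda)\ge m\vee n$ and $\lambda(m,m+d(\lambda)-(m\vee n))\neq\lambda(n,n+d(\lambda)-(m\vee n))$. *)

theory Defs
  imports Complex_Main "HOL-Library.FuncSet" "HOL-Library.Product_Plus" "HOL-Library.Product_Order"
begin

text \<open>
  The semigroup of pairs of naturals is the type \<^typ>\<open>nat \<times> nat\<close> with the coordinatewise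
  addition, order, \<^const>\<open>sup\<close> and \<^const>\<open>inf\<close> of the imported theories.
  A function from \<open>S\<close> to \<open>A\<close> is an element of \<open>S \<rightarrow>\<^sub>E A\<close> (value \<^const>\<open>undefined\<close> off \<open>S\<close>), so that
  equality of such functions is equality on \<open>S\<close>.
\<close>

type_synonym 'a pattern = "nat \<times> nat \<Rightarrow> 'a"

definition e1 :: "nat \<times> nat" where "e1 = (1, 0)"
definition e2 :: "nat \<times> nat" where "e2 = (0, 1)"

definition translate :: "(nat \<times> nat) set \<Rightarrow> nat \<times> nat \<Rightarrow> (nat \<times> nat) set" where
  "translate S n = (\<lambda>m. m + n) ` S"


subsection \<open>Tiles and basic data\<close>

definition tile :: "(nat \<times> nat) set \<Rightarrow> bool" where
  "tile T \<longleftrightarrow> finite T \<and> T \<noteq> {} \<and> (\<forall>n\<in>T. \<forall>m\<le>n. m \<in> T)"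

definition nondegenerate_tile :: "(nat \<times> nat) set \<Rightarrow> bool" where
  "nondegenerate_tile T \<longleftrightarrow> tile T \<and> card T \<ge> 2"

definition corner1 :: "(nat \<times> nat) set \<Rightarrow> nat \<times> nat" where
  "corner1 T = (Max (fst ` T), 0)"

definition corner2 :: "(nat \<times> nat) set \<Rightarrow> nat \<times> nat" where
  "corner2 T = (0, Max (snd ` T))"

definition inner :: "(nat \<times> nat) set \<Rightarrow> (nat \<times> nat) set" where
  "inner T = T - {corner1 T, corner2 T}"

definition basic_data ::
  "(nat \<times> nat) set \<Rightarrow> 'a set \<Rightarrow> ('a pattern \<Rightarrow> 'a \<Rightarrow> 'a) \<Rightarrow> bool" where
  "basic_data T A f \<longleftrightarrow>
     nondegenerate_tile T \<and> finite A \<and> A \<noteq> {} \<and> (\<forall>p \<in> inner T \<rightarrow>\<^sub>E A. bij_betw (f p) A A)"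


subsection \<open>The 2-graph of basic data\<close>

definition vertex_pattern ::
  "(nat \<times> nat) set \<Rightarrow> ('a pattern \<Rightarrow> 'a \<Rightarrow> 'a) \<Rightarrow> 'a pattern \<Rightarrow> 'a \<Rightarrow> 'a pattern" where
  "vertex_pattern T f p a =
     (\<lambda>t\<in>T. if t = corner2 T then a else if t = corner1 T then f p a else p t)"

definition vertices ::
  "(nat \<times> nat) set \<Rightarrow> 'a set \<Rightarrow> ('a pattern \<Rightarrow> 'a \<Rightarrow> 'a) \<Rightarrow> 'a pattern set" where
  "vertices T A f = {vertex_pattern T f p a | p a. p \<in> inner T \<rightarrow>\<^sub>E A \<and> a \<in> A}"

text \<open>The domain \<open>T(n)\<close> of a path of degree \<open>n\<close>.\<close>

definition path_domain :: "(nat \<times> nat) set \<Rightarrow> nat \<times> nat \<Rightarrow> (nat \<times> nat) set" where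
  "path_domain T n = (\<Union>m\<in>{..n}. translate T m)"

text \<open>\<open>window T n g\<close> is the restriction of \<open>g\<close> to \<open>T + n\<close>, moved back to \<open>T\<close>.\<close>

definition window :: "(nat \<times> nat) set \<Rightarrow> nat \<times> nat \<Rightarrow> 'a pattern \<Rightarrow> 'a pattern" where
  "window T n g = (\<lambda>i\<in>T. g (i + n))"

text \<open>
  Since \<^const>\<open>undefined\<close> may belong to \<open>A\<close>, one and the same HOL function can represent paths of
  several degrees. A path is therefore always accompanied by its degree: notions that depend
  on it take the degree as an argument.
\<close>

definition paths ::
  "(nat \<times> nat) set \<Rightarrow> 'a set \<Rightarrow> ('a pattern \<Rightarrow> 'a \<Rightarrow> 'a) \<Rightarrow> nat \<times> nat \<Rightarrow> 'a pattern set" where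
  "paths T A f n = {l \<in> path_domain T n \<rightarrow>\<^sub>E A. \<forall>m\<le>n. window T m l \<in> vertices T A f}"

definition path_range :: "(nat \<times> nat) set \<Rightarrow> 'a pattern \<Rightarrow> 'a pattern" where
  "path_range T l = window T 0 l"

definition path_source :: "(nat \<times> nat) set \<Rightarrow> nat \<times> nat \<Rightarrow> 'a pattern \<Rightarrow> 'a pattern" where
  "path_source T n l = window T n l"

text \<open>The path \<open>l(m,n)\<close>, used only for \<open>m \<le> n\<close>.\<close>

definition segment ::
  "(nat \<times> nat) set \<Rightarrow> 'a pattern \<Rightarrow> nat \<times> nat \<Rightarrow> nat \<times> nat \<Rightarrow> 'a pattern" where
  "segment T l m n = (\<lambda>i\<in>path_domain T (n - m). l (m + i))"

text \<open>
  The composite of a path \<open>x\<close> of degree \<open>m\<close> with a path \<open>y\<close> of degree \<open>n\<close>, meaningful when the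
  source of \<open>x\<close> is the range of \<open>y\<close>. It completes the description of the category; segments are
  given explicitly above, so the aperiodicity condition does not mention it.
\<close>

definition path_comp ::
  "(nat \<times> nat) set \<Rightarrow> 'a set \<Rightarrow> ('a pattern \<Rightarrow> 'a \<Rightarrow> 'a) \<Rightarrow>
     nat \<times> nat \<Rightarrow> nat \<times> nat \<Rightarrow> 'a pattern \<Rightarrow> 'a pattern \<Rightarrow> 'a pattern" where
  "path_comp T A f m n x y =
     (THE l. l \<in> paths T A f (m + n) \<and> segment T l 0 m = x \<and> segment T l m (m + n) = y)"

definition paths_between ::
  "(nat \<times> nat) set \<Rightarrow> 'a set \<Rightarrow> ('a pattern \<Rightarrow> 'a \<Rightarrow> 'a) \<Rightarrow>
     'a pattern \<Rightarrow> nat \<times> nat \<Rightarrow> 'a pattern \<Rightarrow> 'a pattern set" where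
  "paths_between T A f u n v =
     {l \<in> paths T A f n. path_range T l = u \<and> path_source T n l = v}"


subsection \<open>Breaking cycles\<close>

text \<open>
  Edges of the cycle have degree \<open>d\<close>, and \<open>d'\<close> is the other basis vector. The conditional
  expression implements the convention \<open>v\<^bsub>k+1\<^esub> = v\<^sub>1\<close>.
\<close>

definition breaking_cycle_dir ::
  "(nat \<times> nat) set \<Rightarrow> 'a set \<Rightarrow> ('a pattern \<Rightarrow> 'a \<Rightarrow> 'a) \<Rightarrow>
     nat \<times> nat \<Rightarrow> nat \<times> nat \<Rightarrow> 'a \<Rightarrow> bool" where
  "breaking_cycle_dir T A f d d' a \<longleftrightarrow>
     T \<inter> translate T d' \<noteq> {} \<and>
     (\<exists>k>1. \<exists>v :: nat \<Rightarrow> 'a pattern.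
        (\<forall>i\<in>{1..k}. v i \<in> vertices T A f) \<and> inj_on v {1..k} \<and>
        (\<forall>i\<in>{1..k}. \<forall>t \<in> T \<inter> translate T d'. v i t = a) \<and>
        ((\<forall>i\<in>{1..k}. card (paths_between T A f (v i) d (v (if i = k then 1 else i + 1))) = 1) \<or>
         (\<forall>i\<in>{1..k}. card (paths_between T A f (v i) d (v i)) = 1)))"

definition blue_breaking_cycle ::
  "(nat \<times> nat) set \<Rightarrow> 'a set \<Rightarrow> ('a pattern \<Rightarrow> 'a \<Rightarrow> 'a) \<Rightarrow> 'a \<Rightarrow> bool" where
  "blue_breaking_cycle T A f a \<longleftrightarrow> breaking_cycle_dir T A f e1 e2 a"

definition red_breaking_cycle ::
  "(nat \<times> nat) set \<Rightarrow> 'a set \<Rightarrow> ('a pattern \<Rightarrow> 'a \<Rightarrow> 'a) \<Rightarrow> 'a \<Rightarrow> bool" where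
  "red_breaking_cycle T A f a \<longleftrightarrow> breaking_cycle_dir T A f e2 e1 a"

definition breaking_cycle ::
  "(nat \<times> nat) set \<Rightarrow> 'a set \<Rightarrow> ('a pattern \<Rightarrow> 'a \<Rightarrow> 'a) \<Rightarrow> 'a \<Rightarrow> bool" where
  "breaking_cycle T A f a \<longleftrightarrow> blue_breaking_cycle T A f a \<or> red_breaking_cycle T A f a"


subsection \<open>Aperiodicity\<close>

text \<open>
  Here \<open>l\<close> ranges over all paths and \<open>d\<close> is its degree. Both segments have degree
  \<open>d - sup m n\<close>, so comparing them as HOL functions is comparing them as paths.
\<close>

definition aperiodic ::
  "(nat \<times> nat) set \<Rightarrow> 'a set \<Rightarrow> ('a pattern \<Rightarrow> 'a \<Rightarrow> 'a) \<Rightarrow> bool" where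
  "aperiodic T A f \<longleftrightarrow>
     (\<forall>v\<in>vertices T A f. \<forall>m n. m \<noteq> n \<and> inf m n = 0 \<longrightarrow>
        (\<exists>d. \<exists>l\<in>paths T A f d. path_range T l = v \<and> sup m n \<le> d \<and>
           segment T l m (m + (d - sup m n)) \<noteq> segment T l n (n + (d - sup m n))))"

end

theory Submission
  imports Defs "HOL-Combinatorics.Transposition"
begin

text \<open>
  Suppose that all paths with range \<open>u\<close> satisfy \<open>l (m + i) = l (n + i)\<close>; call \<open>u\<close> periodic for
  \<open>m, n\<close>. Since \<open>inf m n = 0\<close>, either one of the two shifts is \<open>0\<close>, or they are \<open>(p, 0)\<close> and \<open>(0, q)\<close>
  with \<open>p, q > 0\<close>. A breaking cycle forces the tile to have positive width and height.

  If \<open>n = 0\<close>, periodicity fails without dynamics. A vertex condition determines the label at one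
  corner from the others, so a path can be built column by column and then row by row, filling at
  each step a single corner cell. Some cell of the last translate of the tile is never filled in
  this way; its label is free and can be made different from the one that periodicity
  prescribes (\<open>not_periodic_at_zero\<close>).

  For \<open>(p, 0)\<close> and \<open>(0, q)\<close> take a blue breaking cycle; the red case is its transpose. Call a vertex
  flat if it is constantly \<open>a\<close> above its bottom row. Let \<open>R\<close> be the set of periodic vertices.

  \<^item> \<open>R\<close> is closed under following edges, because a path can be prolonged at its range
    (\<open>prepend\<close>, \<open>periodic_at_successor\<close>).

  \<^item> \<open>R\<close> is closed under following edges of degree \<open>e2\<close> backwards. The idea is recurrence: a closed
    set of a finite system whose moves are permutations is also closed under their inverses
    (\<open>predecessor_in_closed_set\<close>).

  \<^item> Hence if \<open>R\<close> has one element, then it contains all flat vertices. Writing \<open>a\<close> to the right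
    of a vertex leads to some flat vertex, and any two flat vertices have a common successor in
    direction \<open>e2\<close>, as they differ in the bottom row only (\<open>flat_in_biclosed_set\<close>).

  A breaking cycle gives two orbits \<open>w\<close>, \<open>w'\<close> of flat vertices in direction \<open>e1\<close> that differ at every
  time. There are paths of degree \<open>(p, q)\<close> over these two orbits that agree above row \<open>0\<close>
  (\<open>tilings_over_flat_orbits\<close>). Periodicity of \<open>w 0\<close> and \<open>w' 0\<close> then equates both \<open>w p\<close> and \<open>w' p\<close>
  with the same pattern in row \<open>q\<close>, a contradiction (\<open>not_periodic_at\<close>).
\<close>

section \<open>Paths as restrictions of labellings of the whole quadrant\<close>

text \<open>
  Paths are represented by total labellings of the quadrant of which only the windows at positions
  up to the degree matter. Prolonging or modifying a path then needs no change of domain.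
\<close>

definition tiling ::
  "(nat \<times> nat) set \<Rightarrow> 'a set \<Rightarrow> 'a pattern set \<Rightarrow> nat \<times> nat \<Rightarrow> 'a pattern \<Rightarrow> bool" where
  "tiling T A V d g \<longleftrightarrow> range g \<subseteq> A \<and> (\<forall>k\<le>d. window T k g \<in> V)"

text \<open>
  The negation of the aperiodicity condition at the vertex \<open>u\<close>, with the equality of the two
  segments expressed window by window. All degrees \<open>d\<close> and offsets \<open>k\<close> are included, so that the
  property passes to the successors of \<open>u\<close>.
\<close>

definition periodic_at ::
  "(nat \<times> nat) set \<Rightarrow> 'a set \<Rightarrow> 'a pattern set \<Rightarrow> nat \<times> nat \<Rightarrow> nat \<times> nat \<Rightarrow> 'a pattern \<Rightarrow> bool" where
  "periodic_at T A V m n u \<longleftrightarrow>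
     (\<forall>g d k. tiling T A V d g \<longrightarrow> window T 0 g = u \<longrightarrow> k + sup m n \<le> d \<longrightarrow>
        window T (m + k) g = window T (n + k) g)"

text \<open>
  For a basis vector \<open>e\<close>, there is an edge of degree \<open>e\<close> with range \<open>u\<close> and source \<open>w\<close>: such an
  edge is determined by its two windows, which only have to agree on their overlap.
\<close>

definition successor ::
  "(nat \<times> nat) set \<Rightarrow> 'a pattern set \<Rightarrow> nat \<times> nat \<Rightarrow> 'a pattern \<Rightarrow> 'a pattern \<Rightarrow> bool" where
  "successor T V e u w \<longleftrightarrow>
     u \<in> V \<and> w \<in> V \<and> (\<forall>t\<in>T. t + e \<in> T \<longrightarrow> w t = u (t + e))"

definition flat :: "(nat \<times> nat) set \<Rightarrow> 'a \<Rightarrow> 'a pattern \<Rightarrow> bool" where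
  "flat T a u \<longleftrightarrow> (\<forall>i j. (i, Suc j) \<in> T \<longrightarrow> u (i, Suc j) = a)"

lemma in_translate_iff: "x \<in> translate T k \<longleftrightarrow> (\<exists>t\<in>T. x = t + k)"
  by (auto simp: translate_def)

lemma finite_atMost_prod: "finite {..d :: nat \<times> nat}"
proof -
  have "{..d} = {..fst d} \<times> {..snd d}" by (auto simp: less_eq_prod_def)
  then show ?thesis by simp
qed

lemma window_cong:
  assumes "\<And>t. t \<in> T \<Longrightarrow> g (t + k) = h (t + l)"
  shows "window T k g = window T l h"
  using assms by (auto simp: window_def restrict_def fun_eq_iff)

lemma window_app: "t \<in> T \<Longrightarrow> window T k g t = g (t + k)"
  by (simp add: window_def)

lemma periodic_atD:
  assumes "periodic_at T A V m n u" "tiling T A V d g" "window T 0 g = u" "k + sup m n \<le> d"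
  shows "window T (m + k) g = window T (n + k) g"
  using assms unfolding periodic_at_def by blast

section \<open>Corner rules and the filling of corner cells\<close>

text \<open>
  What is used of basic data: the label at either corner of a vertex is determined by the other
  labels, which can be arbitrary. In this form the hypotheses are symmetric under transposition
  of the quadrant.
\<close>

locale corner_rule =
  fixes T :: "(nat \<times> nat) set" and A :: "'a set" and V :: "'a pattern set" and c1 c2 :: nat
  assumes finite_A: "finite A"
    and hereditary: "\<And>i j i' j'. (i, j) \<in> T \<Longrightarrow> i' \<le> i \<Longrightarrow> j' \<le> j \<Longrightarrow> (i', j') \<in> T"
    and corner1_in: "(c1, 0) \<in> T" and corner2_in: "(0, c2) \<in> T"
    and bound: "\<And>i j. (i, j) \<in> T \<Longrightarrow> i \<le> c1 \<and> j \<le> c2"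
    and V_sub: "V \<subseteq> T \<rightarrow>\<^sub>E A"
    and solve1: "\<And>g. \<forall>x\<in>T. g x \<in> A \<Longrightarrow> \<exists>!b. b \<in> A \<and> restrict (g((c1, 0) := b)) T \<in> V"
    and solve2: "\<And>g. \<forall>x\<in>T. g x \<in> A \<Longrightarrow> \<exists>!b. b \<in> A \<and> restrict (g((0, c2) := b)) T \<in> V"
begin

lemma finite_T: "finite T"
proof (rule finite_subset)
  show "T \<subseteq> {..c1} \<times> {..c2}" using bound by auto
qed simp

lemma finite_V: "finite V"
  using V_sub finite_PiE[OF finite_T, of "\<lambda>_. A"] finite_A finite_subset by blast

lemma V_in: "u \<in> V \<Longrightarrow> t \<in> T \<Longrightarrow> u t \<in> A"
  using V_sub by (auto simp: PiE_def)

lemma eq_if_agree_off_corner: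
  assumes uw: "u \<in> V" "w \<in> V" and c: "c = (c1, 0) \<or> c = (0, c2)"
    and agree: "\<And>t. t \<in> T \<Longrightarrow> t \<noteq> c \<Longrightarrow> u t = w t"
  shows "u = w"
proof -
  have ext: "u \<in> extensional T" "w \<in> extensional T" using uw V_sub by (auto simp: PiE_def)
  have cT: "c \<in> T" using c corner1_in corner2_in by auto
  have "\<exists>!b. b \<in> A \<and> restrict (u(c := b)) T \<in> V"
    using c solve1[of u] solve2[of u] V_in[OF uw(1)] by auto
  moreover have "restrict (u(c := u c)) T = u" using ext(1) by (simp add: extensional_restrict)
  moreover have "restrict (u(c := w c)) T = w"
    using ext(2) agree by (auto simp: restrict_def fun_eq_iff extensional_def)
  ultimately have "u c = w c" using V_in uw cT by metis
  then show ?thesis using ext agree by (intro extensionalityI[of u T w]) auto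
qed

lemma vertex_with_values_off_corner:
  assumes c: "c = (c1, 0) \<or> c = (0, c2)" and g: "\<And>t. t \<in> T \<Longrightarrow> g t \<in> A"
  obtains w where "w \<in> V" "\<And>t. t \<in> T \<Longrightarrow> t \<noteq> c \<Longrightarrow> w t = g t"
proof -
  obtain b where "restrict (g(c := b)) T \<in> V"
    using c solve1[of g] solve2[of g] g by blast
  then show ?thesis by (rule that) simp
qed

text \<open>
  A wrong window at \<open>l\<close> is repaired by changing the label of its corner cell \<open>c + l\<close>. This spoils only
  windows that contain that cell, and these have larger rank; so the windows in \<open>Q\<close> are repaired
  in the order of increasing rank.
\<close>

lemma fill:
  fixes rank :: "nat \<times> nat \<Rightarrow> int"
  assumes c: "c = (c1, 0) \<or> c = (0, c2)"
    and rank: "\<And>k l. c + l \<in> translate T k \<Longrightarrow> k \<noteq> l \<Longrightarrow> rank l < rank k"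
    and Q: "finite Q" and g: "range g \<subseteq> A"
    and I: "\<And>k. k \<in> I \<Longrightarrow> window T k g \<in> V"
    and IQ: "\<And>k l. k \<in> I \<Longrightarrow> l \<in> Q \<Longrightarrow> c + l \<notin> translate T k"
  shows "\<exists>g'. range g' \<subseteq> A \<and> (\<forall>k\<in>I \<union> Q. window T k g' \<in> V) \<and>
           (\<forall>x. x \<notin> (+) c ` Q \<longrightarrow> g' x = g x)"
  using Q IQ
proof (induction Q rule: finite_ranking_induct[where f = rank])
  case empty
  then show ?case using g I by (intro exI[of _ g]) auto
next
  case (insert l Q)
  obtain g1 where g1: "range g1 \<subseteq> A" "\<And>k. k \<in> I \<union> Q \<Longrightarrow> window T k g1 \<in> V"
    "\<And>x. x \<notin> (+) c ` Q \<Longrightarrow> g1 x = g x"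
    using insert by (metis (no_types, lifting) insertCI)
  show ?case
  proof (cases "l \<in> Q")
    case True
    then show ?thesis using g1 by (intro exI[of _ g1]) (auto simp: insert_absorb)
  next
    case False
    have "\<exists>b\<in>A. restrict ((\<lambda>i. g1 (i + l))(c := b)) T \<in> V"
      using c solve1[of "\<lambda>i. g1 (i + l)"] solve2[of "\<lambda>i. g1 (i + l)"] g1(1) by blast
    then obtain b where b: "b \<in> A" "restrict ((\<lambda>i. g1 (i + l))(c := b)) T \<in> V" by blast
    let ?g = "g1(c + l := b)"
    have 1: "window T l ?g \<in> V"
    proof -
      have "window T l ?g = restrict ((\<lambda>i. g1 (i + l))(c := b)) T"
        by (auto simp: window_def restrict_def fun_eq_iff)
      then show ?thesis using b by simp
    qed
    have 2: "window T k ?g \<in> V" if k: "k \<in> I \<union> Q" for k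
    proof -
      have "c + l \<notin> translate T k"
      proof (cases "k \<in> I")
        case True
        then show ?thesis using insert.prems by blast
      next
        case False
        then have "k \<in> Q" using k by blast
        then have "rank k \<le> rank l" "k \<noteq> l" using insert.hyps \<open>l \<notin> Q\<close> by auto
        then show ?thesis using rank[of l k] by linarith
      qed
      then have "window T k ?g = window T k g1"
        by (intro window_cong) (auto simp: in_translate_iff)
      then show ?thesis using g1(2)[OF k] by simp
    qed
    show ?thesis
    proof (intro exI[of _ ?g] conjI ballI allI impI)
      show "range ?g \<subseteq> A" using g1(1) b(1) by auto
      show "window T k ?g \<in> V" if "k \<in> I \<union> insert l Q" for k using 1 2 that by blast
      show "?g x = g x" if "x \<notin> (+) c ` insert l Q" for x using that g1(3)[of x] by auto
    qed
  qed
qed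

text \<open>
  The tile lies weakly to the left of its first corner and above row \<open>0\<close>, so the other translates
  through that corner cell of a translate are those shifted to the right or down. For the second
  corner they are those shifted up or to the left.
\<close>

lemma rank_corner1:
  assumes "(c1, 0) + l \<in> translate T k" "k \<noteq> l"
  shows "int (fst l) - int (snd l) < int (fst k) - int (snd k)"
  using assms bound by (cases k; cases l) (fastforce simp: in_translate_iff)

lemma rank_corner2:
  assumes "(0, c2) + l \<in> translate T k" "k \<noteq> l"
  shows "int (snd l) - int (fst l) < int (snd k) - int (fst k)"
  using assms bound by (cases k; cases l) (fastforce simp: in_translate_iff)

lemmas fill_corner1 = fill[OF disjI1[OF refl] rank_corner1]
lemmas fill_corner2 = fill[OF disjI2[OF refl] rank_corner2]

text \<open>
  New rows are completed from right to left through the second corner, which is why labels beyond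
  column \<open>p\<close> remain free in the new rows.
\<close>

lemma extend_up:
  assumes g: "tiling T A V (p, 0) g"
  obtains g' where "tiling T A V (p, q) g'"
    "\<And>x. p < fst x \<or> snd x \<le> c2 \<Longrightarrow> g' x = g x"
proof -
  let ?I = "{..p} \<times> {0}" and ?Q = "{..p} \<times> {1..q}"
  have "\<exists>g'. range g' \<subseteq> A \<and> (\<forall>k\<in>?I \<union> ?Q. window T k g' \<in> V) \<and>
           (\<forall>x. x \<notin> (+) (0, c2) ` ?Q \<longrightarrow> g' x = g x)"
  proof (rule fill_corner2)
    show "(0, c2) + l \<notin> translate T k" if "k \<in> ?I" "l \<in> ?Q" for k l
      using that bound by (fastforce simp: in_translate_iff)
  qed (use g in \<open>auto simp: tiling_def\<close>)
  then obtain g' where g': "range g' \<subseteq> A" "\<And>k. k \<in> ?I \<union> ?Q \<Longrightarrow> window T k g' \<in> V"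
    "\<And>x. x \<notin> (+) (0, c2) ` ?Q \<Longrightarrow> g' x = g x" by blast
  show ?thesis
  proof (rule that)
    show "tiling T A V (p, q) g'" unfolding tiling_def
    proof (intro conjI allI impI)
      fix k assume "k \<le> (p, q)"
      then have "k \<in> ?I \<union> ?Q" by (cases k) auto
      then show "window T k g' \<in> V" by (rule g'(2))
    qed (rule g'(1))
    show "g' x = g x" if "p < fst x \<or> snd x \<le> c2" for x
      using that by (intro g'(3)) auto
  qed
qed

text \<open>
  A path of any degree exists whose labels are prescribed outside the corner cells: the bottom row
  is completed to the right through the first corner, and the rest by \<open>extend_up\<close>.
\<close>

lemma extend:
  assumes g: "range g \<subseteq> A" "window T 0 g \<in> V"
  obtains g' where "tiling T A V (p, q) g'"
    "\<And>x. 0 < snd x \<or> fst x \<le> c1 \<Longrightarrow> p < fst x \<or> snd x \<le> c2 \<Longrightarrow> g' x = g x"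
proof -
  let ?Q = "{1..p} \<times> {0}"
  have "\<exists>g'. range g' \<subseteq> A \<and> (\<forall>k\<in>{0} \<union> ?Q. window T k g' \<in> V) \<and>
           (\<forall>x. x \<notin> (+) (c1, 0) ` ?Q \<longrightarrow> g' x = g x)"
  proof (rule fill_corner1)
    show "(c1, 0) + l \<notin> translate T k" if "k \<in> {0}" "l \<in> ?Q" for k l
      using that bound by (fastforce simp: in_translate_iff)
  qed (use g in auto)
  then obtain g1 where g1: "range g1 \<subseteq> A" "\<And>k. k \<in> {0} \<union> ?Q \<Longrightarrow> window T k g1 \<in> V"
    "\<And>x. x \<notin> (+) (c1, 0) ` ?Q \<Longrightarrow> g1 x = g x" by blast
  have "tiling T A V (p, 0) g1" unfolding tiling_def
  proof (intro conjI allI impI)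
    fix k assume "k \<le> (p, 0 :: nat)"
    then have "k \<in> {0} \<union> ?Q" by (cases k) (auto simp: zero_prod_def)
    then show "window T k g1 \<in> V" by (rule g1(2))
  qed (rule g1(1))
  then obtain g2 where g2: "tiling T A V (p, q) g2"
    "\<And>x. p < fst x \<or> snd x \<le> c2 \<Longrightarrow> g2 x = g1 x"
    using extend_up[of p g1 q] by blast
  show ?thesis
  proof (rule that[OF g2(1)])
    fix x :: "nat \<times> nat" assume x: "0 < snd x \<or> fst x \<le> c1" "p < fst x \<or> snd x \<le> c2"
    have "g1 x = g x" using x(1) by (intro g1(3)) auto
    then show "g2 x = g x" using g2(2)[OF x(2)] by simp
  qed
qed

section \<open>Periodicity passes to successors\<close>

text \<open>
  Composition of an edge of degree \<open>e\<close> with a path. The path is shifted by \<open>e\<close> and the range of the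
  edge is put at the origin; the windows along the boundary that the shift leaves open are then
  repaired at the corner \<open>c\<close>, whose cells lie in that boundary and outside the tile at the origin.
\<close>

lemma prepend:
  fixes rank :: "nat \<times> nat \<Rightarrow> int"
  assumes c: "c = (c1, 0) \<or> c = (0, c2)"
    and rank: "\<And>k l. c + l \<in> translate T k \<Longrightarrow> k \<noteq> l \<Longrightarrow> rank l < rank k"
    and off: "\<And>l. \<not> e \<le> l \<Longrightarrow> \<not> e \<le> c + l"
    and out: "\<And>l. \<not> e \<le> l \<Longrightarrow> l \<noteq> 0 \<Longrightarrow> c + l \<notin> T"
    and uw: "successor T V e u w" and g: "tiling T A V d g" "window T 0 g = w"
  obtains g' where "tiling T A V (d + e) g'" "window T 0 g' = u"
    "\<And>k. window T (k + e) g' = window T k g"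
proof -
  have u: "u \<in> V" and w: "\<And>t. t \<in> T \<Longrightarrow> t + e \<in> T \<Longrightarrow> w t = u (t + e)"
    using uw by (auto simp: successor_def)
  define g0 where "g0 x = (if e \<le> x then g (x - e) else if x \<in> T then u x else g 0)" for x
  have gA: "g x \<in> A" for x using g by (auto simp: tiling_def)
  have shift: "x - e + e = x" if "e \<le> x" for x
    using that by (auto simp: less_eq_prod_def prod_eq_iff)
  have shift': "x + e - e = x" for x by simp
  have le: "e \<le> x + e" for x by (auto simp: less_eq_prod_def)
  have g0_0: "window T 0 g0 = u"
  proof (rule extensionalityI[of _ T])
    show "window T 0 g0 \<in> extensional T" by (simp add: window_def)
    show "u \<in> extensional T" using u V_sub by (auto simp: PiE_def)
    fix t assume t: "t \<in> T"
    show "window T 0 g0 t = u t"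
    proof (cases "e \<le> t")
      case True
      have tT: "t - e \<in> T" using t hereditary by (cases t) (auto simp: minus_prod_def)
      have "g (t - e) = w (t - e)" using g(2) window_app[OF tT, of 0 g] by simp
      also have "\<dots> = u t" using w[OF tT] t shift[OF True] by simp
      finally show ?thesis using True t by (simp add: window_app g0_def)
    qed (use t in \<open>simp add: window_app g0_def\<close>)
  qed
  have g0_e: "window T (k + e) g0 = window T k g" for k
    by (rule window_cong) (simp add: g0_def le flip: add.assoc)
  let ?I = "insert 0 ((\<lambda>k. k + e) ` {..d})" and ?Q = "{l. l \<le> d + e \<and> \<not> e \<le> l \<and> l \<noteq> 0}"
  have "\<exists>g'. range g' \<subseteq> A \<and> (\<forall>k\<in>?I \<union> ?Q. window T k g' \<in> V) \<and>
           (\<forall>x. x \<notin> (+) c ` ?Q \<longrightarrow> g' x = g0 x)"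
  proof (rule fill[OF c rank])
    show "finite ?Q" by (rule finite_subset[OF _ finite_atMost_prod[of "d + e"]]) auto
    show "range g0 \<subseteq> A"
      by (rule image_subsetI) (simp add: g0_def gA V_in[OF u])
    show "window T k g0 \<in> V" if "k \<in> ?I" for k
      using that g0_0 u g0_e g(1) by (auto simp: tiling_def)
    show "c + l \<notin> translate T k" if "k \<in> ?I" "l \<in> ?Q" for k l
    proof (cases "k = 0")
      case True
      then show ?thesis using that out[of l] by (auto simp: in_translate_iff)
    next
      case False
      then have "e \<le> k" using that le by auto
      then have "e \<le> t + k" for t by (auto simp: less_eq_prod_def)
      then show ?thesis using that off[of l] by (auto simp: in_translate_iff)
    qed
  qed
  then obtain g' where g': "range g' \<subseteq> A" "\<And>k. k \<in> ?I \<union> ?Q \<Longrightarrow> window T k g' \<in> V"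
    "\<And>x. x \<notin> (+) c ` ?Q \<Longrightarrow> g' x = g0 x" by blast
  show ?thesis
  proof (rule that)
    show "tiling T A V (d + e) g'" unfolding tiling_def
    proof (intro conjI allI impI)
      fix k assume k: "k \<le> d + e"
      have "k - e \<le> d" using k by (auto simp: less_eq_prod_def)
      then have "k \<in> ?I \<union> ?Q" using k shift[of k] by (cases "e \<le> k") force+
      then show "window T k g' \<in> V" by (rule g'(2))
    qed (rule g'(1))
    have "window T 0 g' = window T 0 g0"
      using out by (intro window_cong g'(3)[THEN trans]) auto
    then show "window T 0 g' = u" using g0_0 by simp
    show "window T (k + e) g' = window T k g" for k
    proof -
      have "g' (t + (k + e)) = g0 (t + (k + e))" for t
        using off le[of "t + k"] by (intro g'(3)) (auto simp: add.assoc)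
      then have "window T (k + e) g' = window T (k + e) g0" by (intro window_cong)
      then show ?thesis using g0_e by simp
    qed
  qed
qed

lemma periodic_at_successor:
  assumes e: "e = e1 \<or> e = e2" and uw: "successor T V e u w" and u: "periodic_at T A V m n u"
  shows "periodic_at T A V m n w"
  unfolding periodic_at_def
proof (intro allI impI)
  fix g d k assume g: "tiling T A V d g" "window T 0 g = w" and k: "k + sup m n \<le> d"
  obtain g' where g': "tiling T A V (d + e) g'" "window T 0 g' = u"
    "\<And>k. window T (k + e) g' = window T k g"
    using e
  proof
    assume "e = e1"
    show ?thesis
    proof (rule prepend[OF disjI2[OF refl] rank_corner2 _ _ uw g that])
      show "\<not> e \<le> (0, c2) + l" if "\<not> e \<le> l" for l
        using that \<open>e = e1\<close> by (auto simp: e1_def less_eq_prod_def)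
      show "(0, c2) + l \<notin> T" if "\<not> e \<le> l" "l \<noteq> 0" for l
        using that \<open>e = e1\<close> bound
        by (cases l) (fastforce simp: e1_def less_eq_prod_def zero_prod_def)
    qed
  next
    assume "e = e2"
    show ?thesis
    proof (rule prepend[OF disjI1[OF refl] rank_corner1 _ _ uw g that])
      show "\<not> e \<le> (c1, 0) + l" if "\<not> e \<le> l" for l
        using that \<open>e = e2\<close> by (auto simp: e2_def less_eq_prod_def)
      show "(c1, 0) + l \<notin> T" if "\<not> e \<le> l" "l \<noteq> 0" for l
        using that \<open>e = e2\<close> bound
        by (cases l) (fastforce simp: e2_def less_eq_prod_def zero_prod_def)
    qed
  qed
  have "(k + e) + sup m n \<le> d + e" using k by (auto simp: less_eq_prod_def)
  then have "window T (m + (k + e)) g' = window T (n + (k + e)) g'"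
    by (rule periodic_atD[OF u g'(1,2)])
  then show "window T (m + k) g = window T (n + k) g"
    using g'(3)[of "m + k"] g'(3)[of "n + k"] by (simp add: add.assoc)
qed

lemma column_top:
  assumes "(i, 0) \<in> T"
  obtains j where "(i, j) \<in> T" "(i, Suc j) \<notin> T"
proof -
  have "\<exists>j. (i, j) \<notin> T" using bound[of i "Suc c2"] by auto
  then obtain j where "(i, j) \<notin> T" "\<And>j'. j' < j \<Longrightarrow> (i, j') \<in> T"
    using exists_least_iff[of "\<lambda>j. (i, j) \<notin> T"] by blast
  then show ?thesis using that assms by (cases j) auto
qed

lemma row_end:
  assumes "(0, j) \<in> T"
  obtains i where "(i, j) \<in> T" "(Suc i, j) \<notin> T"
proof -
  have "\<exists>i. (i, j) \<notin> T" using bound[of "Suc c1" j] by auto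
  then obtain i where "(i, j) \<notin> T" "\<And>i'. i' < i \<Longrightarrow> (i', j) \<in> T"
    using exists_least_iff[of "\<lambda>i. (i, j) \<notin> T"] by blast
  then show ?thesis using that assms by (cases i) auto
qed

section \<open>Sets closed under successors\<close>

text \<open>
  The map \<open>\<Psi>\<close> moves the window of a vertex up by one row. The new cells are the tops of the columns;
  the one in column \<open>i > 0\<close> receives the old bottom label of column \<open>i - 1\<close>, and the one in column \<open>0\<close>,
  the second corner, is determined. No information is lost, since the remaining old bottom label
  sat at the first corner; so \<open>\<Psi>\<close> permutes the finite set \<open>V\<close> and moves along edges of degree \<open>e2\<close>.
  To make it send \<open>v\<close> to the given successor \<open>u\<close>, each stored label is first subjected to a
  transposition of labels. A permutation that maps the finite set \<open>R\<close> into itself maps it onto itself,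
  so the preimage \<open>v\<close> of \<open>u\<close> is in \<open>R\<close>.
\<close>

lemma predecessor_in_closed_set:
  assumes RV: "R \<subseteq> V"
    and closed: "\<And>z w. z \<in> R \<Longrightarrow> successor T V e2 z w \<Longrightarrow> w \<in> R"
    and u: "u \<in> R" and vu: "successor T V e2 v u"
  shows "v \<in> R"
proof -
  define new where "new z t =
    (if (fst t, Suc (snd t)) \<in> T then z (fst t, Suc (snd t))
     else transpose (v (fst t - 1, 0)) (u t) (z (fst t - 1, 0)))" for z :: "'a pattern" and t
  have v: "v \<in> V" and uV: "u \<in> V" and vu': "\<And>t. t \<in> T \<Longrightarrow> t + e2 \<in> T \<Longrightarrow> u t = v (t + e2)"
    using vu by (auto simp: successor_def)
  have base: "(i - 1, 0) \<in> T" if "(i, j) \<in> T" for i j using that hereditary by simp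
  have newA: "new z t \<in> A" if "z \<in> V" "t \<in> T" for z t
    using that V_in[OF v base] V_in[OF uV] V_in[OF \<open>z \<in> V\<close>] base
    by (cases t) (auto simp: new_def transpose_def)
  have "\<exists>w. w \<in> V \<and> (\<forall>t\<in>T - {(0, c2)}. w t = new z t)" if z: "z \<in> V" for z
  proof -
    obtain w where "w \<in> V" "\<And>t. t \<in> T \<Longrightarrow> t \<noteq> (0, c2) \<Longrightarrow> w t = new z t"
      by (rule vertex_with_values_off_corner[OF disjI2[OF refl], of "new z"]) (use newA z in auto)
    then show ?thesis by blast
  qed
  then obtain \<Psi> where \<Psi>_ex: "\<forall>z\<in>V. \<Psi> z \<in> V \<and> (\<forall>t\<in>T - {(0, c2)}. \<Psi> z t = new z t)"
    using bchoice[of V "\<lambda>z w. w \<in> V \<and> (\<forall>t\<in>T - {(0, c2)}. w t = new z t)"] by blast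
  then have \<Psi>V: "\<And>z. z \<in> V \<Longrightarrow> \<Psi> z \<in> V"
    and \<Psi>: "\<And>z t. z \<in> V \<Longrightarrow> t \<in> T \<Longrightarrow> t \<noteq> (0, c2) \<Longrightarrow> \<Psi> z t = new z t"
    by blast+
  have up: "(0, Suc c2) \<notin> T" using bound by fastforce
  have inj: "inj_on \<Psi> V"
  proof (rule inj_onI)
    fix z z' assume z: "z \<in> V" "z' \<in> V" and eq: "\<Psi> z = \<Psi> z'"
    have new_eq: "new z t = new z' t" if "t \<in> T" "t \<noteq> (0, c2)" for t
      using \<Psi> z eq that by metis
    show "z = z'"
    proof (rule eq_if_agree_off_corner[OF z disjI1[OF refl]])
      fix t assume t: "t \<in> T" "t \<noteq> (c1, 0)"
      obtain i j where ij: "t = (i, j)" by (cases t)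
      show "z t = z' t"
      proof (cases j)
        case (Suc j')
        have "(i, j') \<in> T" using t ij Suc hereditary by simp
        moreover have "(i, j') \<noteq> (0, c2)" using t ij Suc up by auto
        ultimately have "new z (i, j') = new z' (i, j')" by (rule new_eq)
        then show ?thesis using t ij Suc by (simp add: new_def)
      next
        case 0
        then have "i < c1" using t ij bound[of i 0] by auto
        then have "(Suc i, 0) \<in> T" using corner1_in hereditary by simp
        then obtain l where l: "(Suc i, l) \<in> T" "(Suc i, Suc l) \<notin> T" by (rule column_top)
        have "new z (Suc i, l) = new z' (Suc i, l)" using new_eq l by simp
        then show ?thesis using l ij 0 by (simp add: new_def inj_eq[OF inj_transpose])
      qed
    qed
  qed
  have \<Psi>R: "\<Psi> z \<in> R" if "z \<in> R" for z
  proof (rule closed[OF that])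
    have "z \<in> V" using that RV by blast
    moreover have "\<Psi> z t = z (t + e2)" if "t \<in> T" "t + e2 \<in> T" for t
    proof -
      have "t \<noteq> (0, c2)" using that up by (auto simp: e2_def)
      then show ?thesis using \<Psi>[OF \<open>z \<in> V\<close> that(1)] that(2)
        by (cases t) (simp add: new_def e2_def)
    qed
    ultimately show "successor T V e2 z (\<Psi> z)" using \<Psi>V by (simp add: successor_def)
  qed
  have "\<Psi> ` R = R"
    using \<Psi>R inj RV finite_V by (intro endo_inj_surj) (auto intro: finite_subset inj_on_subset)
  then have "u \<in> \<Psi> ` R" using u by simp
  then obtain z where z: "z \<in> R" "\<Psi> z = u" by (rule imageE) simp
  have "\<Psi> v = u"
  proof (rule eq_if_agree_off_corner[OF \<Psi>V[OF v] uV disjI2[OF refl]])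
    fix t assume t: "t \<in> T" "t \<noteq> (0, c2)"
    then show "\<Psi> v t = u t"
      using \<Psi>[OF v t] vu'[OF t(1)] by (cases t) (auto simp: new_def e2_def)
  qed
  then have "v = z" using inj_onD[OF inj, of v z] z v RV by auto
  then show ?thesis using z by simp
qed

text \<open>
  Moving right repeatedly and writing \<open>a\<close> into the new cells above row \<open>0\<close> pushes all old labels
  out of these rows.
\<close>

lemma flat_in_closed_set:
  assumes a: "a \<in> A" and RV: "R \<subseteq> V"
    and closed: "\<And>z w. z \<in> R \<Longrightarrow> successor T V e1 z w \<Longrightarrow> w \<in> R"
    and u: "u \<in> R"
  shows "\<exists>w\<in>R. flat T a w"
proof -
  \<comment> \<open>after \<open>n\<close> steps the last \<open>n\<close> cells of each row above the bottom are labelled \<open>a\<close>\<close>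
  have "\<exists>w\<in>R. \<forall>i j. (i, Suc j) \<in> T \<longrightarrow> (i + n, Suc j) \<notin> T \<longrightarrow> w (i, Suc j) = a" for n
  proof (induction n)
    case 0
    then show ?case using u by auto
  next
    case (Suc n)
    then obtain z where z: "z \<in> R"
      "\<And>i j. (i, Suc j) \<in> T \<Longrightarrow> (i + n, Suc j) \<notin> T \<Longrightarrow> z (i, Suc j) = a" by blast
    have zV: "z \<in> V" using z RV by blast
    define g where "g t = (if t + e1 \<in> T then z (t + e1) else a)" for t
    have gA: "g t \<in> A" if "t \<in> T" for t using V_in[OF zV] a by (simp add: g_def)
    obtain w where w: "w \<in> V" "\<And>t. t \<in> T \<Longrightarrow> t \<noteq> (c1, 0) \<Longrightarrow> w t = g t"
      by (rule vertex_with_values_off_corner[of "(c1, 0)" g]) (use gA in auto)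
    have "successor T V e1 z w"
      unfolding successor_def
    proof (intro conjI ballI impI)
      fix t assume t: "t \<in> T" "t + e1 \<in> T"
      then have "t \<noteq> (c1, 0)" using bound[of "Suc c1" 0] by (auto simp: e1_def)
      then show "w t = z (t + e1)" using w t by (simp add: g_def)
    qed (use zV w in auto)
    then have "w \<in> R" using closed z by blast
    moreover have "w (i, Suc j) = a" if "(i, Suc j) \<in> T" "(i + Suc n, Suc j) \<notin> T" for i j
      using w(2)[OF that(1)] z(2)[of "Suc i" j] that by (auto simp: g_def e1_def)
    ultimately show ?case by blast
  qed
  then obtain w where "w \<in> R"
    "\<And>i j. (i, Suc j) \<in> T \<Longrightarrow> (i + Suc c1, Suc j) \<notin> T \<Longrightarrow> w (i, Suc j) = a"
    by blast
  moreover have "(i + Suc c1, j) \<notin> T" for i j using bound[of "i + Suc c1" j] by auto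
  ultimately show ?thesis unfolding flat_def by blast
qed

text \<open>
  The successors of a vertex in direction \<open>e2\<close> do not depend on its bottom row. So \<open>v\<close> and a flat
  vertex of \<open>R\<close> have a common successor, from which one steps back to \<open>v\<close>.
\<close>

lemma flat_in_biclosed_set:
  assumes a: "a \<in> A" and RV: "R \<subseteq> V"
    and closed: "\<And>e z w. e = e1 \<or> e = e2 \<Longrightarrow> z \<in> R \<Longrightarrow> successor T V e z w \<Longrightarrow> w \<in> R"
    and u: "u \<in> R" and v: "v \<in> V" "flat T a v"
  shows "v \<in> R"
proof -
  obtain v0 where v0: "v0 \<in> R" "flat T a v0"
    using flat_in_closed_set[OF a RV _ u] closed by blast
  define g where "g t = (if t + e2 \<in> T then v0 (t + e2) else a)" for t
  have "v0 \<in> V" using v0 RV by blast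
  then have gA: "g t \<in> A" for t using V_in a by (simp add: g_def)
  obtain w where w: "w \<in> V" "\<And>t. t \<in> T \<Longrightarrow> t \<noteq> (0, c2) \<Longrightarrow> w t = g t"
    by (rule vertex_with_values_off_corner[of "(0, c2)" g]) (use gA in auto)
  have wa: "w t = v0 (t + e2) \<and> w t = v (t + e2)" if t: "t \<in> T" "t + e2 \<in> T" for t
  proof -
    have "t \<noteq> (0, c2)" using t bound[of 0 "Suc c2"] by (auto simp: e2_def)
    then show ?thesis
      using w(2)[OF t(1)] t v0(2) v(2) by (cases t) (auto simp: g_def flat_def e2_def)
  qed
  have "successor T V e2 v0 w" "successor T V e2 v w"
    unfolding successor_def using wa w(1) v(1) \<open>v0 \<in> V\<close> by blast+
  then have "w \<in> R" using closed v0 by blast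
  then show ?thesis
    using predecessor_in_closed_set[OF RV _ _ \<open>successor T V e2 v w\<close>] closed by blast
qed

section \<open>Breaking periods\<close>

lemma not_periodic_at_zero:
  assumes pos: "0 < c1" "0 < c2" and A2: "a \<in> A" "b \<in> A" "a \<noteq> b"
    and u: "u \<in> V" and pq: "(p, q) \<noteq> 0"
  shows "\<exists>g. tiling T A V (p, q) g \<and> window T 0 g = u \<and> window T (p, q) g \<noteq> window T 0 g"
proof -
  \<comment> \<open>A cell outside the tile that no repair in \<open>extend\<close> touches: it is not in row \<open>0\<close>, and it is
    either to the right of column \<open>p\<close> or not above the tile. The end of the top row and the top of
    the last column serve when the shift is horizontal and when it is not.\<close>
  have "\<exists>t\<in>T. t + (p, q) \<notin> T \<and> 0 < snd (t + (p, q)) \<and>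
          (p < fst (t + (p, q)) \<or> snd (t + (p, q)) \<le> c2)"
  proof (cases "q = 0")
    case True
    obtain i where i: "(i, c2) \<in> T" "(Suc i, c2) \<notin> T" using row_end[OF corner2_in] .
    have "(i + p, c2) \<notin> T" using i(2) hereditary[of "i + p" c2 "Suc i" c2] pq True
      by (cases p) (auto simp: zero_prod_def)
    then show ?thesis using i True pos by (intro bexI[of _ "(i, c2)"]) auto
  next
    case False
    obtain j where j: "(c1, j) \<in> T" "(c1, Suc j) \<notin> T" using column_top[OF corner1_in] .
    have "(c1 + p, j + q) \<notin> T"
      using j(2) hereditary[of "c1 + p" "j + q" c1 "Suc j"] False by (cases q) auto
    then show ?thesis using j False pos by (intro bexI[of _ "(c1, j)"]) auto
  qed
  then obtain t where t: "t \<in> T" "t + (p, q) \<notin> T" "0 < snd (t + (p, q))"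
    "p < fst (t + (p, q)) \<or> snd (t + (p, q)) \<le> c2" by blast
  define b' where "b' = (if u t = a then b else a)"
  have b': "b' \<in> A" "b' \<noteq> u t" using A2 by (auto simp: b'_def)
  define g where "g x = (if x \<in> T then u x else b')" for x
  have ext: "u \<in> extensional T" using u V_sub by (auto simp: PiE_def)
  have g0: "window T 0 g = u"
    using ext by (auto simp: window_def g_def fun_eq_iff restrict_def extensional_def)
  have "range g \<subseteq> A" using V_in[OF u] b' by (auto simp: g_def)
  then obtain g' where g': "tiling T A V (p, q) g'"
    "\<And>x. 0 < snd x \<or> fst x \<le> c1 \<Longrightarrow> p < fst x \<or> snd x \<le> c2 \<Longrightarrow> g' x = g x"
    using extend[of g p q] g0 u by blast
  have eqT: "g' x = g x" if "x \<in> T" for x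
    using that bound[of "fst x" "snd x"] by (intro g'(2)) auto
  have w0: "window T 0 g' = u"
    unfolding g0[symmetric] by (rule window_cong) (simp add: eqT)
  have "g' (t + (p, q)) = b'" using g'(2)[OF disjI1[OF t(3)] t(4)] t(2) by (simp add: g_def)
  then have "window T (p, q) g' t \<noteq> window T 0 g' t"
    using t(1) w0 b' by (simp add: window_app)
  then show ?thesis using g' w0 by metis
qed

text \<open>
  An orbit of flat vertices fills the lowest strip with \<open>a\<close> above the bottom row, and the bottom
  row is read off the origins of the vertices. A path over \<open>w\<close> is built upwards from this strip.
  Its bottom row meets only the windows in row \<open>0\<close>, so it can be exchanged for that of \<open>w'\<close>.
\<close>

lemma tilings_over_flat_orbits:
  assumes a: "a \<in> A"
    and w: "\<And>i. flat T a (w i)" "\<And>i. successor T V e1 (w i) (w (Suc i))"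
    and w': "\<And>i. flat T a (w' i)" "\<And>i. successor T V e1 (w' i) (w' (Suc i))"
    and q: "0 < q"
  obtains g g' where "tiling T A V (p, q) g" "tiling T A V (p, q) g'"
    "window T (0, q) g = window T (0, q) g'"
    "\<And>i. i \<le> p \<Longrightarrow> window T (i, 0) g = w i" "\<And>i. i \<le> p \<Longrightarrow> window T (i, 0) g' = w' i"
proof -
  have orbit: "window T (i, 0) g = x i"
    if x: "\<And>i. flat T a (x i)" "\<And>i. successor T V e1 (x i) (x (Suc i))"
      and g0: "\<And>i. g (i, 0) = x i 0" and ga: "\<And>i j. 0 < j \<Longrightarrow> j \<le> c2 \<Longrightarrow> i \<le> p + c1 \<Longrightarrow> g (i, j) = a"
      and i: "i \<le> p"
    for x g i
  proof (rule extensionalityI[of _ T])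
    have "x i \<in> V" using x by (auto simp: successor_def)
    then show "x i \<in> extensional T" using V_sub by (auto simp: PiE_def)
    show "window T (i, 0) g \<in> extensional T" by (simp add: window_def)
    have bottom: "(s, 0) \<in> T \<Longrightarrow> x (i + s) 0 = x i (s, 0)" for s i
    proof (induction s arbitrary: i)
      case (Suc s)
      have "(s, 0) \<in> T" using Suc.prems hereditary by simp
      then show ?case using Suc.IH[of "Suc i"] x(2)[of i] Suc.prems
        by (auto simp: successor_def e1_def)
    qed (simp add: zero_prod_def)
    fix t assume t: "t \<in> T"
    obtain s j where sj: "t = (s, j)" by (cases t)
    show "window T (i, 0) g t = x i t"
    proof (cases j)
      case 0
      then show ?thesis using t sj g0 bottom[of s i] by (simp add: window_app add.commute)
    next
      case (Suc j')
      have "g (s + i, j) = a" using bound[of s j] t sj Suc i by (intro ga) auto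
      then show ?thesis using t sj Suc x(1)[of i] by (simp add: window_app flat_def)
    qed
  qed
  have zero: "(0 :: nat \<times> nat) \<in> T" using corner1_in hereditary[of c1 0 0 0] by (simp add: zero_prod_def)
  have wV: "w i \<in> V" "w' i \<in> V" for i using w w' by (auto simp: successor_def)
  define h where "h y = (if snd y = 0 then w (fst y) 0 else a)" for y :: "nat \<times> nat"
  have "window T (i, 0) h = w i" if "i \<le> p" for i
    by (rule orbit[of w, OF w(1) w(2) _ _ that]) (auto simp: h_def)
  moreover have "range h \<subseteq> A" using a V_in[OF wV(1) zero] by (auto simp: h_def)
  ultimately have "tiling T A V (p, 0) h"
    unfolding tiling_def using wV by (auto simp: less_eq_prod_def)
  then obtain g where g: "tiling T A V (p, q) g"
    "\<And>x. p < fst x \<or> snd x \<le> c2 \<Longrightarrow> g x = h x"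
    using extend_up[of p h q] by blast
  define g' where "g' y = (if snd y = 0 then w' (fst y) 0 else g y)" for y :: "nat \<times> nat"
  have gw: "window T (i, 0) g = w i" if "i \<le> p" for i
    by (rule orbit[of w, OF w(1) w(2) _ _ that]) (auto simp: h_def g)
  have g'w: "window T (i, 0) g' = w' i" if "i \<le> p" for i
    by (rule orbit[of w', OF w'(1) w'(2) _ _ that]) (auto simp: h_def g g'_def)
  have upper: "window T (i, j) g = window T (i, j) g'" if "0 < j" for i j
    using that by (intro window_cong) (auto simp: g'_def)
  have "tiling T A V (p, q) g'"
    unfolding tiling_def
  proof (intro conjI allI impI)
    show "range g' \<subseteq> A"
      using g(1) V_in[OF wV(2) zero] by (auto simp: g'_def tiling_def)
    fix k assume k: "k \<le> (p, q)"
    show "window T k g' \<in> V"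
    proof (cases "snd k = 0")
      case True
      then show ?thesis using k g'w[of "fst k"] wV by (cases k) auto
    next
      case False
      then have "window T k g' = window T k g" using upper[of "snd k" "fst k"] by simp
      moreover have "window T k g \<in> V" using g(1) k unfolding tiling_def by blast
      ultimately show ?thesis by simp
    qed
  qed
  then show ?thesis using that g(1) upper[OF q] gw g'w by blast
qed

lemma not_periodic_at:
  assumes c2: "0 < c2" and a: "a \<in> A"
    and w: "\<And>i. flat T a (w i)" "\<And>i. successor T V e1 (w i) (w (Suc i))"
    and w': "\<And>i. flat T a (w' i)" "\<And>i. successor T V e1 (w' i) (w' (Suc i))"
    and distinct: "\<And>i. w i \<noteq> w' i"
    and u: "u \<in> V" and mn: "m \<noteq> n" "inf m n = 0"
  shows "\<not> periodic_at T A V m n u"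
proof
  assume per: "periodic_at T A V m n u"
  have per': "periodic_at T A V n m u"
    using per unfolding periodic_at_def by (metis sup.commute)
  have wV: "w i \<in> V" "w' i \<in> V" for i using w w' by (auto simp: successor_def)
  \<comment> \<open>The distinct flat vertices differ in the bottom row off the first corner, so the tile is
    more than one column wide and there are two labels.\<close>
  obtain t where t: "t \<in> T" "t \<noteq> (c1, 0)" "w 0 t \<noteq> w' 0 t"
    using eq_if_agree_off_corner[OF wV disjI1[OF refl], of 0 0] distinct[of 0] by blast
  have "snd t = 0"
    using t w(1)[of 0] w'(1)[of 0] by (cases t; cases "snd t") (auto simp: flat_def)
  then have c1: "0 < c1" using t bound[of "fst t" "snd t"] by (cases t) auto
  have A2: "w 0 t \<in> A" "w' 0 t \<in> A" using V_in wV t by auto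
  have no_zero: False if x: "x \<noteq> 0" and perx: "periodic_at T A V x 0 u" for x
  proof -
    obtain p q where pq: "x = (p, q)" by (cases x)
    obtain g where g: "tiling T A V x g" "window T 0 g = u" "window T x g \<noteq> window T 0 g"
      using not_periodic_at_zero[OF c1 c2 A2 t(3) u, of p q] x unfolding pq by blast
    have "0 + sup x 0 \<le> x" by (simp add: less_eq_prod_def sup_prod_def zero_prod_def)
    then have "window T (x + 0) g = window T (0 + 0) g"
      by (rule periodic_atD[OF perx g(1,2)])
    then show False using g(3) by simp
  qed
  have no_antidiagonal: False
    if pq: "0 < p" "0 < q" and per: "periodic_at T A V (p, 0) (0, q) u" for p q
  proof -
    let ?R = "{z \<in> V. periodic_at T A V (p, 0) (0, q) z}"
    have R: "z \<in> ?R" if "z \<in> V" "flat T a z" for z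
    proof (rule flat_in_biclosed_set[OF a _ _ _ that])
      show "y \<in> ?R" if "e = e1 \<or> e = e2" "x \<in> ?R" "successor T V e x y" for e x y
        using that periodic_at_successor[of e x y] unfolding successor_def by blast
    qed (use u per in auto)
    obtain g g' where g: "tiling T A V (p, q) g" "tiling T A V (p, q) g'"
      "window T (0, q) g = window T (0, q) g'"
      "\<And>i. i \<le> p \<Longrightarrow> window T (i, 0) g = w i" "\<And>i. i \<le> p \<Longrightarrow> window T (i, 0) g' = w' i"
      using tilings_over_flat_orbits[of a w w' q p, OF a w(1) w(2) w'(1) w'(2) pq(2)] by blast
    have 0: "0 + sup (p, 0) (0, q) \<le> (p, q)" by (simp add: sup_prod_def)
    have start: "window T 0 g = w 0" "window T 0 g' = w' 0" using g(4,5)[of 0] by (auto simp: zero_prod_def)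
    have "window T ((p, 0) + 0) g = window T ((0, q) + 0) g"
      by (rule periodic_atD[OF _ g(1) start(1) 0]) (use R[OF wV(1) w(1)] in blast)
    moreover have "window T ((p, 0) + 0) g' = window T ((0, q) + 0) g'"
      by (rule periodic_atD[OF _ g(2) start(2) 0]) (use R[OF wV(2) w'(1)] in blast)
    ultimately show False using g(3,4,5) distinct[of p] by simp
  qed
  obtain m1 m2 n1 n2 where eqs: "m = (m1, m2)" "n = (n1, n2)" by (cases m; cases n)
  have min: "m1 = 0 \<or> n1 = 0" "m2 = 0 \<or> n2 = 0"
    using mn(2) eqs by (auto simp: inf_prod_def zero_prod_def inf_nat_def min_def split: if_splits)
  consider "n = 0" | "m = 0" | "m2 = 0" "n1 = 0" "0 < m1" "0 < n2" | "m1 = 0" "n2 = 0" "0 < m2" "0 < n1"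
    using min eqs by (auto simp: zero_prod_def)
  then show False
  proof cases
    case 1
    then show False using no_zero[of m] per mn by simp
  next
    case 2
    then show False using no_zero[of n] per' mn by simp
  next
    case 3
    then show False using no_antidiagonal[of m1 n2] per eqs by simp
  next
    case 4
    then show False using no_antidiagonal[of n1 m2] per' eqs by simp
  qed
qed

end

section \<open>Transposition\<close>

lemma swap_image_iff: "x \<in> prod.swap ` S \<longleftrightarrow> prod.swap x \<in> S"
  by (cases x) simp

lemma swap_plus: "prod.swap (x + y) = prod.swap x + prod.swap (y :: nat \<times> nat)"
  by (cases x; cases y) simp

lemma swap_le: "prod.swap x \<le> y \<longleftrightarrow> x \<le> prod.swap (y :: nat \<times> nat)"
  by (cases x; cases y) auto

lemma comp_swap_image_iff: "u \<in> (\<lambda>u. u \<circ> prod.swap) ` V \<longleftrightarrow> u \<circ> prod.swap \<in> V"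
  by (auto simp: image_iff comp_assoc intro!: bexI[of _ "u \<circ> prod.swap"])

lemma restrict_swap: "restrict g (prod.swap ` S) \<circ> prod.swap = restrict (g \<circ> prod.swap) S"
  by (auto simp: fun_eq_iff restrict_def)

lemma window_swap:
  "window (prod.swap ` S) k g \<circ> prod.swap = window S (prod.swap k) (g \<circ> prod.swap)"
  by (auto simp: window_def restrict_swap comp_def swap_plus)

lemma corner_rule_swap:
  assumes "corner_rule T A V c1 c2"
  shows "corner_rule (prod.swap ` T) A ((\<lambda>u. u \<circ> prod.swap) ` V) c2 c1"
proof -
  interpret corner_rule T A V c1 c2 by (rule assms)
  have upd: "g((i, j) := b) \<circ> prod.swap = (g \<circ> prod.swap)((j, i) := b)"
    for g :: "'a pattern" and i j b
    by (auto simp: fun_eq_iff)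
  show ?thesis
  proof
    show "(\<lambda>u. u \<circ> prod.swap) ` V \<subseteq> prod.swap ` T \<rightarrow>\<^sub>E A"
      using V_sub by (fastforce simp: PiE_iff extensional_def)
    show "\<exists>!b. b \<in> A \<and> restrict (g((c2, 0) := b)) (prod.swap ` T) \<in> (\<lambda>u. u \<circ> prod.swap) ` V"
      if "\<forall>x\<in>prod.swap ` T. g x \<in> A" for g
      unfolding comp_swap_image_iff restrict_swap upd by (rule solve2) (use that in auto)
    show "\<exists>!b. b \<in> A \<and> restrict (g((0, c1) := b)) (prod.swap ` T) \<in> (\<lambda>u. u \<circ> prod.swap) ` V"
      if "\<forall>x\<in>prod.swap ` T. g x \<in> A" for g
      unfolding comp_swap_image_iff restrict_swap upd by (rule solve1) (use that in auto)
  qed (use finite_A corner1_in corner2_in bound in \<open>auto intro: hereditary\<close>)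
qed

lemma successor_swap:
  assumes "successor T V e u w"
  shows "successor (prod.swap ` T) ((\<lambda>u. u \<circ> prod.swap) ` V) (prod.swap e)
           (u \<circ> prod.swap) (w \<circ> prod.swap)"
  unfolding successor_def
proof (intro conjI ballI impI)
  fix t assume "t \<in> prod.swap ` T" "t + prod.swap e \<in> prod.swap ` T"
  then have "prod.swap t \<in> T" "prod.swap t + e \<in> T"
    unfolding swap_image_iff swap_plus by simp_all
  then have "w (prod.swap t) = u (prod.swap t + e)" using assms unfolding successor_def by blast
  then show "(w \<circ> prod.swap) t = (u \<circ> prod.swap) (t + prod.swap e)" by (simp add: swap_plus)
qed (use assms in \<open>unfold successor_def, blast+\<close>)

lemma periodic_at_swap:
  assumes per: "periodic_at T A V m n u"
  shows "periodic_at (prod.swap ` T) A ((\<lambda>u. u \<circ> prod.swap) ` V) (prod.swap m) (prod.swap n)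
           (u \<circ> prod.swap)"
  unfolding periodic_at_def
proof (intro allI impI)
  let ?T = "prod.swap ` T" and ?V = "(\<lambda>u. u \<circ> prod.swap) ` V"
  fix g d k
  assume g: "tiling ?T A ?V d g" "window ?T 0 g = u \<circ> prod.swap"
    and k: "k + sup (prod.swap m) (prod.swap n) \<le> d"
  let ?g = "g \<circ> prod.swap"
  have "tiling T A V (prod.swap d) ?g"
    unfolding tiling_def
  proof (intro conjI allI impI)
    show "range ?g \<subseteq> A" using g(1) by (auto simp: tiling_def)
    fix l assume "l \<le> prod.swap d"
    then have "prod.swap l \<le> d" by (simp add: swap_le)
    then have "window ?T (prod.swap l) g \<in> ?V" using g(1) unfolding tiling_def by blast
    then show "window T l ?g \<in> V" by (simp add: comp_swap_image_iff window_swap)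
  qed
  moreover have "window T 0 ?g = u"
    using window_swap[of T 0 g] unfolding g(2) by (simp add: comp_assoc zero_prod_def)
  moreover have "prod.swap k + sup m n \<le> prod.swap d"
    using k by (cases k; cases d; cases m; cases n) (simp add: sup_prod_def)
  ultimately have "window T (m + prod.swap k) ?g = window T (n + prod.swap k) ?g"
    by (rule periodic_atD[OF per])
  then have "window ?T (prod.swap m + k) g \<circ> prod.swap = window ?T (prod.swap n + k) g \<circ> prod.swap"
    by (simp add: window_swap swap_plus)
  then have "window ?T (prod.swap m + k) g \<circ> prod.swap \<circ> prod.swap =
      window ?T (prod.swap n + k) g \<circ> prod.swap \<circ> prod.swap" by simp
  then show "window ?T (prod.swap m + k) g = window ?T (prod.swap n + k) g"
    by (simp add: comp_assoc)
qed

section \<open>Basic data\<close>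

lemma corners_in_tile:
  assumes "nondegenerate_tile T"
  shows "corner1 T \<in> T" "corner2 T \<in> T" "corner1 T \<noteq> corner2 T"
proof -
  have T: "finite T" "T \<noteq> {}" "\<And>x y. x \<in> T \<Longrightarrow> y \<le> x \<Longrightarrow> y \<in> T"
    using assms by (auto simp: nondegenerate_tile_def tile_def)
  have "Max (fst ` T) \<in> fst ` T" "Max (snd ` T) \<in> snd ` T" using T by (auto intro!: Max_in)
  then obtain x y where xy: "x \<in> T" "fst x = Max (fst ` T)" "y \<in> T" "snd y = Max (snd ` T)"
    by (metis imageE)
  show "corner1 T \<in> T" by (rule T(3)[OF xy(1)]) (simp add: corner1_def less_eq_prod_def xy)
  show "corner2 T \<in> T" by (rule T(3)[OF xy(3)]) (simp add: corner2_def less_eq_prod_def xy)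
  show "corner1 T \<noteq> corner2 T"
  proof
    assume "corner1 T = corner2 T"
    then have 0: "Max (fst ` T) = 0" "Max (snd ` T) = 0" by (auto simp: corner1_def corner2_def)
    have "x = (0, 0)" if "x \<in> T" for x
      using Max_ge[of "fst ` T" "fst x"] Max_ge[of "snd ` T" "snd x"] T(1) that 0
      by (auto simp: prod_eq_iff)
    then have "T \<subseteq> {(0, 0)}" by blast
    then have "card T \<le> card {(0 :: nat, 0 :: nat)}" by (intro card_mono) auto
    then show False using assms by (simp add: nondegenerate_tile_def)
  qed
qed

text \<open>
  The corners are distinct, so the inner part and the label \<open>a\<close> of a vertex pattern can be read off it.
\<close>

lemma vertices_iff:
  assumes bd: "basic_data T A f"
  shows "u \<in> vertices T A f \<longleftrightarrow>
    u \<in> T \<rightarrow>\<^sub>E A \<and> u (corner1 T) = f (restrict u (inner T)) (u (corner2 T))"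
proof
  have c: "corner1 T \<in> T" "corner2 T \<in> T" "corner1 T \<noteq> corner2 T"
    using bd corners_in_tile by (auto simp: basic_data_def)
  have inner_iff: "t \<in> inner T \<longleftrightarrow> t \<in> T \<and> t \<noteq> corner1 T \<and> t \<noteq> corner2 T" for t
    by (auto simp: inner_def)
  {
    assume "u \<in> vertices T A f"
    then obtain p a where pa: "u = vertex_pattern T f p a" "p \<in> inner T \<rightarrow>\<^sub>E A" "a \<in> A"
      by (auto simp: vertices_def)
    have u_T: "u t = (if t = corner2 T then a else if t = corner1 T then f p a else p t)"
      if "t \<in> T" for t
      using that by (simp add: pa(1) vertex_pattern_def)
    have fpa: "f p a \<in> A" using bd pa(2,3) by (auto simp: basic_data_def bij_betw_def)
    have "u \<in> T \<rightarrow>\<^sub>E A"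
    proof (rule PiE_I)
      show "u t \<in> A" if "t \<in> T" for t
        using u_T[OF that] fpa pa(3) PiE_mem[OF pa(2), of t] that by (simp add: inner_iff)
    qed (simp add: pa(1) vertex_pattern_def)
    moreover have "restrict u (inner T) = p"
    proof
      show "restrict u (inner T) t = p t" for t
        using u_T[of t] PiE_arb[OF pa(2), of t] by (cases "t \<in> inner T") (simp_all add: inner_iff)
    qed
    ultimately show "u \<in> T \<rightarrow>\<^sub>E A \<and> u (corner1 T) = f (restrict u (inner T)) (u (corner2 T))"
      using u_T[OF c(1)] u_T[OF c(2)] c(3) by simp
  next
    assume u: "u \<in> T \<rightarrow>\<^sub>E A \<and> u (corner1 T) = f (restrict u (inner T)) (u (corner2 T))"
    have "u = vertex_pattern T f (restrict u (inner T)) (u (corner2 T))"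
    proof
      fix t
      show "u t = vertex_pattern T f (restrict u (inner T)) (u (corner2 T)) t"
        using u PiE_arb[of u T "\<lambda>_. A" t]
        by (cases "t \<in> T") (simp_all add: vertex_pattern_def inner_iff)
    qed
    moreover have "restrict u (inner T) \<in> inner T \<rightarrow>\<^sub>E A" "u (corner2 T) \<in> A"
      using u PiE_mem[of u T "\<lambda>_. A"] c(2) by (simp_all add: inner_iff)
    ultimately show "u \<in> vertices T A f" unfolding vertices_def by blast
  }
qed

lemma corner_rule_basic_data:
  assumes bd: "basic_data T A f"
  shows "corner_rule T A (vertices T A f) (fst (corner1 T)) (snd (corner2 T))"
proof -
  have nT: "nondegenerate_tile T" using bd by (simp add: basic_data_def)
  have c: "corner1 T \<in> T" "corner2 T \<in> T" "corner1 T \<noteq> corner2 T" using corners_in_tile[OF nT] by auto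
  have T: "finite T" "\<And>x y. x \<in> T \<Longrightarrow> y \<le> x \<Longrightarrow> y \<in> T"
    using nT by (auto simp: nondegenerate_tile_def tile_def)
  have eq: "(fst (corner1 T), 0) = corner1 T" "(0, snd (corner2 T)) = corner2 T"
    by (auto simp: corner1_def corner2_def)
  have inner_upd: "restrict (restrict (g(corner1 T := b)) T) (inner T) = restrict g (inner T)"
    "restrict (restrict (g(corner2 T := b)) T) (inner T) = restrict g (inner T)"
    for g :: "'a pattern" and b
    by (auto simp: inner_def fun_eq_iff restrict_def)
  have upd_in: "restrict (g(x := b)) T \<in> T \<rightarrow>\<^sub>E A"
    if "\<forall>x\<in>T. g x \<in> A" "b \<in> A" for g :: "'a pattern" and x b
    using that by auto
  have f: "bij_betw (f (restrict g (inner T))) A A" if "\<forall>x\<in>T. g x \<in> A" for g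
  proof -
    have "restrict g (inner T) \<in> inner T \<rightarrow>\<^sub>E A" using that by (auto simp: inner_def)
    then show ?thesis using bd by (simp add: basic_data_def)
  qed
  show ?thesis
  proof (unfold_locales, unfold eq)
    show "(i', j') \<in> T" if "(i, j) \<in> T" "i' \<le> i" "j' \<le> j" for i j i' j'
      using T(2)[OF that(1)] that by simp
    show "i \<le> fst (corner1 T) \<and> j \<le> snd (corner2 T)" if "(i, j) \<in> T" for i j
      using T(1) that by (force simp: corner1_def corner2_def intro!: Max_ge)
    show "vertices T A f \<subseteq> T \<rightarrow>\<^sub>E A" using vertices_iff[OF bd] by blast
    fix g :: "'a pattern" assume g: "\<forall>x\<in>T. g x \<in> A"
    let ?f = "f (restrict g (inner T))"
    have "b \<in> A \<and> restrict (g(corner1 T := b)) T \<in> vertices T A f \<longleftrightarrow> b \<in> A \<and> b = ?f (g (corner2 T))"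
      for b
      unfolding vertices_iff[OF bd] inner_upd using c upd_in[OF g, of b "corner1 T"] by auto
    moreover have "?f (g (corner2 T)) \<in> A" using f[OF g] g c by (auto simp: bij_betw_def)
    ultimately show "\<exists>!b. b \<in> A \<and> restrict (g(corner1 T := b)) T \<in> vertices T A f" by auto
    have "b \<in> A \<and> restrict (g(corner2 T := b)) T \<in> vertices T A f \<longleftrightarrow> b \<in> A \<and> g (corner1 T) = ?f b"
      for b
      unfolding vertices_iff[OF bd] inner_upd using c upd_in[OF g, of b "corner2 T"] by auto
    moreover have "\<exists>!b. b \<in> A \<and> g (corner1 T) = ?f b"
    proof (rule ex_ex1I)
      have "g (corner1 T) \<in> ?f ` A" using f[OF g] g c unfolding bij_betw_def by blast
      then show "\<exists>b. b \<in> A \<and> g (corner1 T) = ?f b" by blast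
      show "b = b'" if "b \<in> A \<and> g (corner1 T) = ?f b" "b' \<in> A \<and> g (corner1 T) = ?f b'" for b b'
        using f[OF g] that unfolding bij_betw_def inj_on_def by fastforce
    qed
    ultimately show "\<exists>!b. b \<in> A \<and> restrict (g(corner2 T := b)) T \<in> vertices T A f" by simp
  qed (use bd c in \<open>auto simp: basic_data_def\<close>)
qed

lemma successor_if_path:
  assumes "paths_between T A f u e w \<noteq> {}"
  shows "successor T (vertices T A f) e u w"
proof -
  obtain l where l: "l \<in> paths T A f e" "window T 0 l = u" "window T e l = w"
    using assms unfolding paths_between_def path_range_def path_source_def by blast
  have le: "0 \<le> e" by (simp add: less_eq_prod_def)
  then have "u \<in> vertices T A f" "w \<in> vertices T A f" using l unfolding paths_def by blast+
  moreover have "w t = u (t + e)" if "t \<in> T" "t + e \<in> T" for t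
    using that unfolding l(2,3)[symmetric] by (simp add: window_app)
  ultimately show ?thesis by (simp add: successor_def)
qed

text \<open>
  A cycle of length \<open>k > 1\<close> gives the orbits that start at two consecutive vertices; loops at
  distinct vertices give constant orbits.
\<close>

lemma breaking_cycle_orbits:
  assumes "breaking_cycle_dir T A f e e' a"
  obtains w w' where
    "\<And>i t. t \<in> T \<inter> translate T e' \<Longrightarrow> w i t = a"
    "\<And>i. successor T (vertices T A f) e (w i) (w (Suc i))"
    "\<And>i t. t \<in> T \<inter> translate T e' \<Longrightarrow> w' i t = a"
    "\<And>i. successor T (vertices T A f) e (w' i) (w' (Suc i))"
    "\<And>i :: nat. w i \<noteq> w' i"
proof -
  obtain k :: nat and v where k: "1 < k" and inj: "inj_on v {1..k}"
    and a: "\<And>i t. i \<in> {1..k} \<Longrightarrow> t \<in> T \<inter> translate T e' \<Longrightarrow> v i t = a"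
    and cyc: "(\<forall>i\<in>{1..k}. card (paths_between T A f (v i) e (v (if i = k then 1 else i + 1))) = 1) \<or>
         (\<forall>i\<in>{1..k}. card (paths_between T A f (v i) e (v i)) = 1)"
    using assms unfolding breaking_cycle_dir_def by blast
  have succ: "successor T (vertices T A f) e x y" if "card (paths_between T A f x e y) = 1" for x y
    using that by (intro successor_if_path) auto
  from cyc show ?thesis
  proof
    assume cyc: "\<forall>i\<in>{1..k}. card (paths_between T A f (v i) e (v (if i = k then 1 else i + 1))) = 1"
    let ?w = "\<lambda>i. v (Suc (i mod k))"
    have in_k: "Suc (i mod k) \<in> {1..k}" for i using k by (simp add: Suc_leI)
    have step: "successor T (vertices T A f) e (?w i) (?w (Suc i))" for i
      using cyc[rule_format, OF in_k[of i], THEN succ] by (auto simp: mod_Suc)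
    show ?thesis
    proof (rule that[of ?w "\<lambda>i. ?w (Suc i)"])
      show "?w i \<noteq> ?w (Suc i)" for i
        using inj_onD[OF inj _ in_k in_k, of i "Suc i"] k by (auto simp: mod_Suc)
    qed (use step a in_k in blast)+
  next
    assume "\<forall>i\<in>{1..k}. card (paths_between T A f (v i) e (v i)) = 1"
    moreover have 12: "1 \<in> {1..k}" "2 \<in> {1..k}" using k by auto
    ultimately have step: "successor T (vertices T A f) e (v 1) (v 1)"
      "successor T (vertices T A f) e (v 2) (v 2)" using succ by blast+
    show ?thesis
    proof (rule that[of "\<lambda>_. v 1" "\<lambda>_. v 2"])
      show "v 1 \<noteq> v 2" using inj_onD[OF inj _ 12] by auto
    qed (use step a 12 in auto)
  qed
qed

lemma aperiodic_if_not_periodic_at: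
  assumes np: "\<And>u m n. u \<in> vertices T A f \<Longrightarrow> m \<noteq> n \<Longrightarrow> inf m n = 0 \<Longrightarrow>
    \<not> periodic_at T A (vertices T A f) m n u"
  shows "aperiodic T A f"
  unfolding aperiodic_def
proof (intro ballI allI impI)
  fix u and m n :: "nat \<times> nat"
  assume u: "u \<in> vertices T A f" and mn: "m \<noteq> n \<and> inf m n = 0"
  obtain g d k where g: "tiling T A (vertices T A f) d g" "window T 0 g = u" "k + sup m n \<le> d"
    "window T (m + k) g \<noteq> window T (n + k) g"
    using np[OF u] mn unfolding periodic_at_def by blast
  obtain t where t: "t \<in> T" "g (t + (m + k)) \<noteq> g (t + (n + k))"
    using g(4) window_cong[of T g "m + k" g "n + k"] by blast
  have dom: "t + l \<in> path_domain T d" if "t \<in> T" "l \<le> d" for t l d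
    using that by (auto simp: path_domain_def in_translate_iff)
  let ?l = "restrict g (path_domain T d)"
  have win: "window T l ?l = window T l g" if "l \<le> d" for l
    by (rule window_cong) (simp add: dom that)
  have le: "k \<le> d - sup m n" "m + k \<le> d" "n + k \<le> d" "0 \<le> d" "sup m n \<le> d"
    using g(3) by (auto simp: less_eq_prod_def sup_prod_def sup_nat_def)
  have "?l \<in> paths T A f d" unfolding paths_def using g(1) win by (auto simp: tiling_def)
  moreover have "path_range T ?l = u" using g(2) win le by (simp add: path_range_def)
  moreover have "segment T ?l m (m + (d - sup m n)) \<noteq> segment T ?l n (n + (d - sup m n))"
  proof -
    have "segment T ?l x (x + (d - sup m n)) (t + k) = g (t + (x + k))" if "x + k \<le> d" for x
      using dom[OF t(1) le(1)] dom[OF t(1) that] by (simp add: segment_def ac_simps)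
    then show ?thesis using t(2) le(2,3) by metis
  qed
  ultimately show "\<exists>d. \<exists>l\<in>paths T A f d. path_range T l = u \<and> sup m n \<le> d \<and>
      segment T l m (m + (d - sup m n)) \<noteq> segment T l n (n + (d - sup m n))"
    using le(5) by blast
qed

theorem theorem4p5:
  fixes T :: "(nat \<times> nat) set" and A :: "'a set" and f :: "(nat \<times> nat \<Rightarrow> 'a) \<Rightarrow> 'a \<Rightarrow> 'a"
  assumes "basic_data T A f"
    and "\<exists>a\<in>A. breaking_cycle T A f a"
  shows "aperiodic T A f"
proof (rule aperiodic_if_not_periodic_at)
  fix u and m n :: "nat \<times> nat"
  assume u: "u \<in> vertices T A f" and mn: "m \<noteq> n" "inf m n = 0"
  let ?V = "vertices T A f"
  interpret corner_rule T A ?V "fst (corner1 T)" "snd (corner2 T)"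
    by (rule corner_rule_basic_data[OF assms(1)])
  obtain a where a: "a \<in> A" "breaking_cycle T A f a" using assms(2) by blast
  then consider "breaking_cycle_dir T A f e1 e2 a" | "breaking_cycle_dir T A f e2 e1 a"
    by (auto simp: breaking_cycle_def blue_breaking_cycle_def red_breaking_cycle_def)
  then show "\<not> periodic_at T A ?V m n u"
  proof cases
    case 1
    obtain w w' where w: "\<And>i t. t \<in> T \<inter> translate T e2 \<Longrightarrow> w i t = a"
      "\<And>i. successor T ?V e1 (w i) (w (Suc i))"
      and w': "\<And>i t. t \<in> T \<inter> translate T e2 \<Longrightarrow> w' i t = a"
      "\<And>i. successor T ?V e1 (w' i) (w' (Suc i))"
      and distinct: "\<And>i :: nat. w i \<noteq> w' i" by (rule breaking_cycle_orbits[OF 1]) blast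
    have upper: "(i, Suc j) \<in> T \<inter> translate T e2" if "(i, Suc j) \<in> T" for i j
      using that hereditary[OF that, of i j] by (force simp: in_translate_iff e2_def)
    have flat: "flat T a (w i)" "flat T a (w' i)" for i
      using w(1) w'(1) upper by (auto simp: flat_def)
    have "T \<inter> translate T e2 \<noteq> {}" using 1 by (simp add: breaking_cycle_dir_def)
    then have "0 < snd (corner2 T)" using bound by (fastforce simp: in_translate_iff e2_def)
    then show ?thesis
      by (rule not_periodic_at[where w = w and w' = w', OF _ a(1) flat(1) w(2) flat(2) w'(2) distinct u mn])
  next
    case 2
    let ?T = "prod.swap ` T" and ?W = "(\<lambda>u. u \<circ> prod.swap) ` ?V"
    interpret sw: corner_rule ?T A ?W "snd (corner2 T)" "fst (corner1 T)"
      by (rule corner_rule_swap) unfold_locales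
    obtain w w' where w: "\<And>i t. t \<in> T \<inter> translate T e1 \<Longrightarrow> w i t = a"
      "\<And>i. successor T ?V e2 (w i) (w (Suc i))"
      and w': "\<And>i t. t \<in> T \<inter> translate T e1 \<Longrightarrow> w' i t = a"
      "\<And>i. successor T ?V e2 (w' i) (w' (Suc i))"
      and distinct: "\<And>i :: nat. w i \<noteq> w' i" by (rule breaking_cycle_orbits[OF 2]) blast
    have upper: "(Suc j, i) \<in> T \<inter> translate T e1" if "(Suc j, i) \<in> T" for i j
      using that hereditary[OF that, of j i] by (force simp: in_translate_iff e1_def)
    have flat: "flat ?T a (w i \<circ> prod.swap)" "flat ?T a (w' i \<circ> prod.swap)" for i
      using w(1) w'(1) upper by (auto simp: flat_def)
    have "T \<inter> translate T e1 \<noteq> {}" using 2 by (simp add: breaking_cycle_dir_def)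
    then have c: "0 < fst (corner1 T)" using bound by (fastforce simp: in_translate_iff e1_def)
    have e: "prod.swap e2 = e1" by (simp add: e1_def e2_def)
    have neq: "w i \<circ> prod.swap \<noteq> w' i \<circ> prod.swap" for i
    proof
      assume "w i \<circ> prod.swap = w' i \<circ> prod.swap"
      then have "w i \<circ> prod.swap \<circ> prod.swap = w' i \<circ> prod.swap \<circ> prod.swap" by simp
      then show False using distinct[of i] by (simp add: comp_assoc)
    qed
    have mn': "prod.swap m \<noteq> prod.swap n" "inf (prod.swap m) (prod.swap n) = 0"
      using mn by (cases m; cases n; auto simp: inf_prod_def zero_prod_def)+
    have "\<not> periodic_at ?T A ?W (prod.swap m) (prod.swap n) (u \<circ> prod.swap)"
      by (rule sw.not_periodic_at[where w = "\<lambda>i. w i \<circ> prod.swap" and w' = "\<lambda>i. w' i \<circ> prod.swap",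
            OF c a(1) flat(1) successor_swap[OF w(2), unfolded e] flat(2)
              successor_swap[OF w'(2), unfolded e] neq _ mn'])
        (use u in blast)
    then show ?thesis using periodic_at_swap by blast
  qed
qed

end
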